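(* Let $G=(N,A)$ be a directed graph with $N=\{1,\dots,n\}$ and $m$ arcs. If $Q\in\mathbb{R}^{m\times m}$ is a restricted generalized weak sum matrix with supporting matrices $C\in\mathbb{R}^{m\times n}$, $D\in\mathbb{R}^{n\times m}$ and supporting vectors $b,t\in\mathbb{R}^m$, then $Q$ is linearizable with vector $p$ given by $$p_{ij}=b_{ij}+\sum_{k=1}^n c_{ij,k}+\sum_{k=1}^n d_{k,ij}+t_{ij}\qquad\text{for all }(i,j)\in A,$$ i.e. $x^TQx=p^Tx$ for all $x\in X$.
   Context: $G=(N,A)$ is a directed graph, $A\subseteq N\times N$, $|A|=m$; an arc is written $(i,j)$ (from $i$ to $j$), or $ij$ when used as an index, and $Q_{ij,kl}$ denotes the entry of $Q$ indexed by the arcs $(i,j)$ and $(k,l)$. Here $Q$ may have nonzero entries for arbitrary pairs of arcs (not only consecutive ones). For $i\in N$, $\delta^+(i)$ and $\delta^-(i)$ are the sets of arcs leaving and entering $i$. The set of (disjoint) cycle covers is $$X=\Big\{x\in\{0,1\}^m : \sum_{e\in\delta^+(i)}x_e=\sum_{e\in\delta^-(i)}x_e=1\ \ \forall i\in N\Big\}.$$ $Q$ is linearizable with vector $p\in\mathbb{R}^m$ if $x^TQx=p^Tx$ for all $x\in X$. $Q$ is a restricted generalized weak sum matrix with supporting matrices $C=(c_{ij,k})\in\mathbb{R}^{m\times n}$, $D=(d_{k,ij})\in\mathbb{R}^{n\times m}$ and supporting vectors $b,t\in\mathbb{R}^m$ if $Q_{ij,jl}=b_{ij}+c_{ij,l}+d_{i,jl}+t_{jl}$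 for all $i,j,l$ with $(i,j),(j,l)\in A$, and $Q_{ij,kl}=c_{ij,l}+d_{i,kl}$ for all $(i,j),(k,l)\in A$ with $k\neq j$. *)

theory Defs
  imports Complex_Main "HOL-Library.FuncSet" "Graph_Theory.Pair_Digraph"
begin

(* Vectors and matrices indexed by arcs (and vertices) are functions on arcs (and vertices);
   their values outside the arcs and vertices of G are never used. *)

(* Extensionality makes x determined by its entries at the arcs, as for a vector in {0,1}^m. *)
definition cycle_covers :: "'v pair_pre_digraph \<Rightarrow> ('v \<times> 'v \<Rightarrow> real) set" where
  "cycle_covers G = {x \<in> parcs G \<rightarrow>\<^sub>E {0, 1}.
     \<forall>i\<in>pverts G. (\<Sum>e\<in>out_arcs G i. x e) = 1 \<and> (\<Sum>e\<in>in_arcs G i. x e) = 1}"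

definition linearizable_with ::
  "'v pair_pre_digraph \<Rightarrow> ('v \<times> 'v \<Rightarrow> 'v \<times> 'v \<Rightarrow> real) \<Rightarrow> ('v \<times> 'v \<Rightarrow> real) \<Rightarrow> bool" where
  "linearizable_with G Q p \<longleftrightarrow>
     (\<forall>x\<in>cycle_covers G.
        (\<Sum>e\<in>parcs G. \<Sum>f\<in>parcs G. x e * Q e f * x f) = (\<Sum>e\<in>parcs G. p e * x e))"

definition restricted_generalized_weak_sum ::
  "'v pair_pre_digraph \<Rightarrow> ('v \<times> 'v \<Rightarrow> 'v \<times> 'v \<Rightarrow> real) \<Rightarrow>
   ('v \<times> 'v \<Rightarrow> 'v \<Rightarrow> real) \<Rightarrow> ('v \<Rightarrow> 'v \<times> 'v \<Rightarrow> real) \<Rightarrow>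
   ('v \<times> 'v \<Rightarrow> real) \<Rightarrow> ('v \<times> 'v \<Rightarrow> real) \<Rightarrow> bool" where
  "restricted_generalized_weak_sum G Q c d b t \<longleftrightarrow>
     (\<forall>i j l. (i, j) \<in> parcs G \<longrightarrow> (j, l) \<in> parcs G \<longrightarrow>
        Q (i, j) (j, l) = b (i, j) + c (i, j) l + d i (j, l) + t (j, l)) \<and>
     (\<forall>i j k l. (i, j) \<in> parcs G \<longrightarrow> (k, l) \<in> parcs G \<longrightarrow> k \<noteq> j \<longrightarrow>
        Q (i, j) (k, l) = c (i, j) l + d i (k, l))"

end

theory Submission
  imports Defs
begin

text \<open>A cycle cover \<open>x\<close> selects exactly one arc into and one arc out of every vertex, so the head and
  the tail of the selected arcs each run through every vertex exactly once. Hence a weight depending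
  only on the head (or only on the tail) of an arc, summed over the arcs of a cycle cover, has a value
  independent of the cover: the sum of the weights of all vertices.

  The entry \<open>Q e f\<close> equals \<open>c e (snd f) + d (fst e) f\<close>, plus \<open>b e + t f\<close> if \<open>f\<close> starts where \<open>e\<close> ends.
  For fixed \<open>e\<close>, both \<open>c e (snd f)\<close> and the indicator of \<open>fst f = snd e\<close> are weights on one endpoint
  of \<open>f\<close>, so the quadratic form becomes linear in \<open>x\<close> after summation over \<open>f\<close>; these two parts
  contribute the row sum of \<open>c\<close> and the vector \<open>b\<close> to \<open>p\<close>. For fixed \<open>f\<close>, summation over \<open>e\<close>
  treats \<open>d (fst e) f\<close> and \<open>t f\<close> in the same way.\<close>

text \<open>Group the arcs by the endpoint in question: by the degree conditions of a cycle cover, the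
  entries of \<open>x\<close> in the group of a vertex \<open>v\<close> add up to 1, so that group contributes just \<open>w v\<close>.\<close>

lemma sum_over_cycle_cover:
  fixes w :: "'v \<Rightarrow> real"
  assumes "pair_wf_digraph G" and "finite (pverts G)" and "x \<in> cycle_covers G"
  shows sum_head_weight_cycle_cover: "(\<Sum>e\<in>parcs G. w (snd e) * x e) = (\<Sum>v\<in>pverts G. w v)"
    and sum_tail_weight_cycle_cover: "(\<Sum>e\<in>parcs G. w (fst e) * x e) = (\<Sum>v\<in>pverts G. w v)"
proof -
  interpret pair_wf_digraph G by fact
  have ends: "fst ` parcs G \<subseteq> pverts G" "snd ` parcs G \<subseteq> pverts G"
    using in_arcsD1 in_arcsD2 by auto
  have "parcs G \<subseteq> pverts G \<times> pverts G"
    using ends by (auto simp: subset_iff image_iff)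
  then have fin: "finite (parcs G)"
    using assms(2) by (metis finite_SigmaI finite_subset)
  have deg: "(\<Sum>e | e \<in> parcs G \<and> snd e = v. x e) = 1" "(\<Sum>e | e \<in> parcs G \<and> fst e = v. x e) = 1"
    if "v \<in> pverts G" for v
    using assms(3) that unfolding cycle_covers_def in_arcs_def out_arcs_def by auto
  have *: "(\<Sum>e\<in>parcs G. w (h e) * x e) = (\<Sum>v\<in>pverts G. w v)"
    if h: "h ` parcs G \<subseteq> pverts G"
      and one: "\<And>v. v \<in> pverts G \<Longrightarrow> (\<Sum>e | e \<in> parcs G \<and> h e = v. x e) = 1" for h
  proof -
    have "(\<Sum>e\<in>parcs G. w (h e) * x e)
        = (\<Sum>v\<in>pverts G. \<Sum>e | e \<in> parcs G \<and> h e = v. w (h e) * x e)"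
      by (rule sum.group[OF fin assms(2) h, symmetric])
    also have "\<dots> = (\<Sum>v\<in>pverts G. w v * (\<Sum>e | e \<in> parcs G \<and> h e = v. x e))"
      by (auto simp: sum_distrib_left intro!: sum.cong)
    finally show ?thesis
      using one by simp
  qed
  show "(\<Sum>e\<in>parcs G. w (snd e) * x e) = (\<Sum>v\<in>pverts G. w v)"
    using ends(2) deg(1) by (rule *)
  show "(\<Sum>e\<in>parcs G. w (fst e) * x e) = (\<Sum>v\<in>pverts G. w v)"
    using ends(1) deg(2) by (rule *)
qed

lemma restricted_generalized_weak_sum_entry:
  assumes "restricted_generalized_weak_sum G Q c d b t" and "e \<in> parcs G" and "f \<in> parcs G"
  shows "Q e f = (c e (snd f) + (if fst f = snd e then b e else 0))
    + (d (fst e) f + (if snd e = fst f then t f else 0))"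
  using assms unfolding restricted_generalized_weak_sum_def
  by (cases e; cases f) auto

theorem proposition6:
  fixes n :: nat
    and G :: "nat pair_pre_digraph"
    and Q :: "nat \<times> nat \<Rightarrow> nat \<times> nat \<Rightarrow> real"
    and c :: "nat \<times> nat \<Rightarrow> nat \<Rightarrow> real"
    and d :: "nat \<Rightarrow> nat \<times> nat \<Rightarrow> real"
    and b t p :: "nat \<times> nat \<Rightarrow> real"
  assumes "pair_wf_digraph G"
    and "pverts G = {1..n}"
    and "restricted_generalized_weak_sum G Q c d b t"
    and "\<And>i j. (i, j) \<in> parcs G \<Longrightarrow>
           p (i, j) = b (i, j) + (\<Sum>k=1..n. c (i, j) k) + (\<Sum>k=1..n. d k (i, j)) + t (i, j)"
  shows "linearizable_with G Q p"
  unfolding linearizable_with_def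
proof
  fix x assume x: "x \<in> cycle_covers G"
  interpret pair_wf_digraph G by fact
  have fin: "finite (pverts G)"
    using assms(2) by simp
  note head = sum_head_weight_cycle_cover[OF assms(1) fin x]
    and tail = sum_tail_weight_cycle_cover[OF assms(1) fin x]
  let ?V = "pverts G" and ?A = "parcs G"
  let ?B = "\<lambda>e f. if fst f = snd e then b e else 0"
  let ?T = "\<lambda>e f. if snd e = fst f then t f else 0"
  \<comment> \<open>The indicator terms \<open>?B\<close> and \<open>?T\<close> are weights concentrated on a single vertex.\<close>
  have row: "(\<Sum>f\<in>?A. (c e (snd f) + ?B e f) * x f) = (\<Sum>k\<in>?V. c e k) + b e"
    if e: "e \<in> ?A" for e
  proof -
    have "snd e \<in> ?V"
      using e in_arcsD2 by (cases e) auto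
    then show ?thesis
      using head[of "c e"] tail[of "\<lambda>v. if v = snd e then b e else 0"] fin
      by (simp add: distrib_right sum.distrib)
  qed
  have col: "(\<Sum>e\<in>?A. (d (fst e) f + ?T e f) * x e) = (\<Sum>k\<in>?V. d k f) + t f"
    if f: "f \<in> ?A" for f
  proof -
    have "fst f \<in> ?V"
      using f in_arcsD1 by (cases f) auto
    then show ?thesis
      using tail[of "\<lambda>k. d k f"] head[of "\<lambda>v. if v = fst f then t f else 0"] fin
      by (simp add: distrib_right sum.distrib)
  qed
  have entry: "x e * Q e f * x f
      = x e * ((c e (snd f) + ?B e f) * x f) + x f * ((d (fst e) f + ?T e f) * x e)"
    if "e \<in> ?A" "f \<in> ?A" for e f
    unfolding restricted_generalized_weak_sum_entry[OF assms(3) that] by algebra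
  \<comment> \<open>\<open>c\<close> and \<open>b\<close> must be summed over \<open>f\<close> first, \<open>d\<close> and \<open>t\<close> over \<open>e\<close> first, so the form is split
    accordingly and the order of summation is exchanged in the second part only.\<close>
  have "(\<Sum>e\<in>?A. \<Sum>f\<in>?A. x e * Q e f * x f)
      = (\<Sum>e\<in>?A. \<Sum>f\<in>?A. x e * ((c e (snd f) + ?B e f) * x f))
      + (\<Sum>e\<in>?A. \<Sum>f\<in>?A. x f * ((d (fst e) f + ?T e f) * x e))"
    unfolding sum.distrib[symmetric] by (intro sum.cong refl entry)
  also have "(\<Sum>e\<in>?A. \<Sum>f\<in>?A. x f * ((d (fst e) f + ?T e f) * x e))
      = (\<Sum>f\<in>?A. \<Sum>e\<in>?A. x f * ((d (fst e) f + ?T e f) * x e))"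
    by (rule sum.swap)
  also have "(\<Sum>e\<in>?A. \<Sum>f\<in>?A. x e * ((c e (snd f) + ?B e f) * x f)) + \<dots>
      = (\<Sum>e\<in>?A. x e * ((\<Sum>k\<in>?V. c e k) + b e)) + (\<Sum>f\<in>?A. x f * ((\<Sum>k\<in>?V. d k f) + t f))"
    unfolding sum_distrib_left[symmetric]
    by (intro arg_cong2[where f = "(+)"] sum.cong refl) (simp_all only: row col)
  also have "\<dots> = (\<Sum>e\<in>?A. p e * x e)"
    unfolding sum.distrib[symmetric]
    by (intro sum.cong refl) (auto simp: assms(2,4) algebra_simps)
  finally show "(\<Sum>e\<in>?A. \<Sum>f\<in>?A. x e * Q e f * x f) = (\<Sum>e\<in>?A. p e * x e)" .
qed

end
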